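(* Let $(G,T)$ be a facet inducing Steiner graph and let $c$ be facet weights for $(G,T)$. Then there is a laminar root basis for $c$, i.e., there is a laminar family $\mathcal{L}$ of subsets of $V(G)$ such that the cuts $\delta(S)$ ($S\in\mathcal{L}$) form a root basis for $c$.
   Context: Graphs are finite and have no loops or multiple edges. A Steiner graph $(G,T)$ consists of a connected graph $G$ with node set $V(G)$ and edge set $E(G)$ and a set $T\subseteq V(G)$ of terminals with $|T|\ge 2$. For $S\subseteq V(G)$, $\delta(S)=\delta_G(S)$ is the set of edges with exactly one endnode in $S$. The cut $\delta(S)$ is a $T$-Steiner cut if $T\cap S\neq\varnothing$ and $T\setminus S\neq\varnothing$. The $T$-Steiner cut dominant is $\mathrm{CUT}_+(G,T)=\mathrm{conv}\{\chi(\delta(S)) : \delta(S)\text{ a }T\text{-Steiner cut}\}+\mathbb{R}_{\ge 0}^{E(G)}$, where $\chi(\cdot)$ denotes the $0/1$ incidence vector in $\mathbb{R}^{E(G)}$. For $c\in\mathbb{R}^{E(G)}$ and $F\subseteq E(G)$, $c(F)=\sum_{e\in F}c_e$. For a nonnegative vector $c$, $\gamma_c(G,T)$ is the minimum of $c(\delta(S))$ over all $T$-Steiner cuts $\delta(S)$; the $T$-Steiner cuts attaining this minimum are the roots of $c$. A vector is in minimum integer form if its components are nonnegative integers with greatest common divisor one. A vector $c$ provides facet weights for $(G,T)$ if $c$ is in minimum integer form, $c_e>0$ for all $e\in E(G)$, $\gamma_c(G,T)>0$, and the inequality $cx\ge\gamma_c(G,T)$ defines a facet of $\mathrm{CUT}_+(G,T)$;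 $(G,T)$ is facet inducing if it has facet weights. A root basis for $c$ is a set of roots of $c$ whose incidence vectors form a basis of $\mathbb{R}^{E(G)}$; when written as $\delta(S)$ ($S\in\mathcal{L}$), distinct members of $\mathcal{L}$ give distinct basis vectors. Two sets $A,B$ intersect if $A\cap B$, $A\setminus B$ and $B\setminus A$ are all nonempty. A family of subsets is laminar if no two of its members intersect in this sense. *)

theory Defs
  imports "HOL-Analysis.Analysis"
begin

text \<open>
  A graph is a pair of a node set \<open>V\<close> and an edge set \<open>E\<close> of two-element subsets of \<open>V\<close>.
  The finite type \<open>'v\<close> is only a supply of node names: \<open>V\<close> is an arbitrary subset of it.
  Finiteness of \<open>'v\<close> makes \<open>real ^ 'v set\<close> a Euclidean space, in which the space of
  real vectors indexed by \<open>E\<close> is the coordinate subspace \<open>edge_space E\<close>.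
\<close>

definition simple_graph :: "'v::finite set \<Rightarrow> 'v set set \<Rightarrow> bool" where
  "simple_graph V E \<longleftrightarrow> (\<forall>e\<in>E. e \<subseteq> V \<and> card e = 2)"

definition connected_graph :: "'v::finite set \<Rightarrow> 'v set set \<Rightarrow> bool" where
  "connected_graph V E \<longleftrightarrow>
     V \<noteq> {} \<and> (\<forall>u\<in>V. \<forall>v\<in>V. (u, v) \<in> {(x, y). {x, y} \<in> E}\<^sup>*)"

definition steiner_graph :: "'v::finite set \<Rightarrow> 'v set set \<Rightarrow> 'v set \<Rightarrow> bool" where
  "steiner_graph V E T \<longleftrightarrow>
     simple_graph V E \<and> connected_graph V E \<and> T \<subseteq> V \<and> card T \<ge> 2"

definition edge_cut :: "'v::finite set set \<Rightarrow> 'v set \<Rightarrow> 'v set set" where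
  "edge_cut E S = {e \<in> E. card (e \<inter> S) = 1}"

definition steiner_cuts :: "'v::finite set \<Rightarrow> 'v set set \<Rightarrow> 'v set \<Rightarrow> 'v set set set" where
  "steiner_cuts V E T = {edge_cut E S | S. S \<subseteq> V \<and> T \<inter> S \<noteq> {} \<and> T - S \<noteq> {}}"

definition edge_space :: "'v::finite set set \<Rightarrow> (real ^ ('v set)) set" where
  "edge_space E = {x. \<forall>e. e \<notin> E \<longrightarrow> x $ e = 0}"

definition incidence :: "'v::finite set set \<Rightarrow> real ^ ('v set)" where
  "incidence F = (\<chi> e. if e \<in> F then 1 else 0)"

definition cut_dominant ::
    "'v::finite set \<Rightarrow> 'v set set \<Rightarrow> 'v set \<Rightarrow> (real ^ ('v set)) set" where
  "cut_dominant V E T =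
     {x + y | x y. x \<in> convex hull (incidence ` steiner_cuts V E T) \<and>
                   y \<in> edge_space E \<and> (\<forall>e\<in>E. y $ e \<ge> 0)}"

definition weight :: "real ^ ('v::finite set) \<Rightarrow> 'v set set \<Rightarrow> real" where
  "weight c F = (\<Sum>e\<in>F. c $ e)"

definition min_cut_weight ::
    "'v::finite set \<Rightarrow> 'v set set \<Rightarrow> 'v set \<Rightarrow> real ^ ('v set) \<Rightarrow> real" where
  "min_cut_weight V E T c = Min (weight c ` steiner_cuts V E T)"

definition roots ::
    "'v::finite set \<Rightarrow> 'v set set \<Rightarrow> 'v set \<Rightarrow> real ^ ('v set) \<Rightarrow> 'v set set set" where
  "roots V E T c = {F \<in> steiner_cuts V E T. weight c F = min_cut_weight V E T c}"

definition minimum_integer_form :: "'v::finite set set \<Rightarrow> real ^ ('v set) \<Rightarrow> bool" where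
  "minimum_integer_form E c \<longleftrightarrow>
     (\<exists>w :: 'v set \<Rightarrow> nat. (\<forall>e\<in>E. c $ e = real (w e)) \<and> Gcd (w ` E) = 1)"

text \<open>
  The dimension of a facet is relative to the affine dimension of \<open>P\<close>. Validity of the
  inequality on \<open>P\<close> is required separately, since \<open>facet_of\<close> does not distinguish its two sides.
\<close>

definition defines_facet ::
    "'n::euclidean_space \<Rightarrow> real \<Rightarrow> 'n set \<Rightarrow> bool" where
  "defines_facet c b P \<longleftrightarrow>
     (\<forall>x\<in>P. c \<bullet> x \<ge> b) \<and> {x \<in> P. c \<bullet> x = b} facet_of P"

definition facet_weights ::
    "'v::finite set \<Rightarrow> 'v set set \<Rightarrow> 'v set \<Rightarrow> real ^ ('v set) \<Rightarrow> bool" where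
  "facet_weights V E T c \<longleftrightarrow>
     c \<in> edge_space E \<and> minimum_integer_form E c \<and> (\<forall>e\<in>E. c $ e > 0) \<and>
     min_cut_weight V E T c > 0 \<and>
     defines_facet c (min_cut_weight V E T c) (cut_dominant V E T)"

definition facet_inducing :: "'v::finite set \<Rightarrow> 'v set set \<Rightarrow> 'v set \<Rightarrow> bool" where
  "facet_inducing V E T \<longleftrightarrow> (\<exists>c. facet_weights V E T c)"

definition root_basis ::
    "'v::finite set \<Rightarrow> 'v set set \<Rightarrow> 'v set \<Rightarrow> real ^ ('v set) \<Rightarrow> 'v set set set \<Rightarrow> bool" where
  "root_basis V E T c R \<longleftrightarrow>
     R \<subseteq> roots V E T c \<and> independent (incidence ` R) \<and> span (incidence ` R) = edge_space E"

definition intersecting :: "'v set \<Rightarrow> 'v set \<Rightarrow> bool" where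
  "intersecting A B \<longleftrightarrow> A \<inter> B \<noteq> {} \<and> A - B \<noteq> {} \<and> B - A \<noteq> {}"

definition laminar :: "'v set set \<Rightarrow> bool" where
  "laminar \<L> \<longleftrightarrow> (\<forall>A\<in>\<L>. \<forall>B\<in>\<L>. \<not> intersecting A B)"

end

theory Submission imports Defs begin

text \<open>
  Since \<open>c > 0\<close>, the face defined by \<open>c\<close> contains only convex combinations of roots; it misses the
  origin and has codimension one in the full-dimensional cut dominant, so the roots span the edge
  space. Represent every root by its shore avoiding a fixed node. If two such shores \<open>A\<close>, \<open>B\<close>
  intersect, then either \<open>A \<inter> B\<close>, \<open>A \<union> B\<close> or \<open>A - B\<close>, \<open>B - A\<close> are both Steiner; by submodularity and
  \<open>c > 0\<close> they give roots again, with the same sum of incidence vectors. A maximal laminar family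
  of shores therefore spans: a shore outside the span that intersects the fewest
  members could be uncrossed with a member, leaving a shore outside the span that intersects
  fewer.
\<close>

section \<open>Laminar families and uncrossing\<close>

lemma intersecting_commute: "intersecting A B \<longleftrightarrow> intersecting B A"
  unfolding intersecting_def by blast

lemma not_intersecting_self: "\<not> intersecting A A"
  unfolding intersecting_def by blast

lemma laminar_subset: "laminar L \<Longrightarrow> K \<subseteq> L \<Longrightarrow> laminar K"
  unfolding laminar_def by blast

lemma laminar_insert:
  assumes "laminar L" "\<And>A. A \<in> L \<Longrightarrow> \<not> intersecting S A"
  shows "laminar (insert S L)"
  using assms intersecting_commute not_intersecting_self unfolding laminar_def by blast

text \<open>Since \<open>L\<close> contains \<open>A\<close>, lies in \<open>A\<close> or is
  disjoint from \<open>A\<close>, the witnesses that \<open>S\<close> crosses \<open>L\<close> come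
  from \<open>X\<close> crossing \<open>L\<close> or from \<open>S\<close> crossing
  \<open>A\<close>. So uncrossing \<open>S\<close> with \<open>A\<close> creates no crossing with a
  set that \<open>A\<close> does not cross.\<close>

lemma uncrossing_intersecting:
  assumes "intersecting S A" "\<not> intersecting L A"
    and "X = S \<inter> A \<or> X = S \<union> A \<or> X = S - A \<or> X = A - S"
    and "intersecting X L"
  shows "intersecting S L"
  using assms unfolding intersecting_def by (elim disjE) (simp_all, blast+)

lemma uncrossing_not_intersecting:
  assumes "X = S \<inter> A \<or> X = S \<union> A \<or> X = S - A \<or> X = A - S"
  shows "\<not> intersecting X A"
  using assms unfolding intersecting_def by blast

text \<open>The map \<open>f\<close> is arbitrary because the argument uses only that one of the two
  uncrossings stays in the family and preserves the sum of the \<open>f\<close>-values.\<close>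

lemma laminar_spanning_subfamily:
  fixes f :: "'a set \<Rightarrow> 'b::real_vector"
  assumes fin: "finite \<S>"
    and uncross: "\<And>A B. A \<in> \<S> \<Longrightarrow> B \<in> \<S> \<Longrightarrow> intersecting A B \<Longrightarrow>
        (A \<inter> B \<in> \<S> \<and> A \<union> B \<in> \<S> \<and> f A + f B = f (A \<inter> B) + f (A \<union> B)) \<or>
        (A - B \<in> \<S> \<and> B - A \<in> \<S> \<and> f A + f B = f (A - B) + f (B - A))"
  obtains \<L> where "\<L> \<subseteq> \<S>" "laminar \<L>" "f ` \<S> \<subseteq> span (f ` \<L>)"
proof -
  define \<F> where "\<F> = {\<L>. \<L> \<subseteq> \<S> \<and> laminar \<L>}"
  have "finite \<F>" unfolding \<F>_def using fin by (auto intro: finite_subset[of _ "Pow \<S>"])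
  moreover have "{} \<in> \<F>" unfolding \<F>_def laminar_def by simp
  ultimately obtain \<L> where LF: "\<L> \<in> \<F>" and max: "\<And>K. K \<in> \<F> \<Longrightarrow> \<L> \<subseteq> K \<Longrightarrow> \<L> = K"
    by (metis empty_iff finite_has_maximal)
  have L: "\<L> \<subseteq> \<S>" "laminar \<L>" using LF by (auto simp: \<F>_def)
  have finL: "finite \<L>" using L fin finite_subset by blast
  have in_span: "f S \<in> span (f ` \<L>)" if "S \<in> \<S>" for S
    using that
  proof (induction "card {B \<in> \<L>. intersecting S B}" arbitrary: S rule: less_induct)
    case less
    show ?case
    proof (cases "\<exists>A\<in>\<L>. intersecting S A")
      case False
      \<comment> \<open>A set crossing no member can be added to \<open>\<L>\<close>, so by
        maximality it is already there.\<close>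
      then have "insert S \<L> \<in> \<F>" using L less.prems laminar_insert[of \<L> S] by (auto simp: \<F>_def)
      then have "S \<in> \<L>" using max by blast
      then show ?thesis by (simp add: span_base)
    next
      case True
      then obtain A where A: "A \<in> \<L>" "intersecting S A" by blast
      have IH: "f X \<in> span (f ` \<L>)"
        if "X \<in> \<S>" and X: "X = S \<inter> A \<or> X = S \<union> A \<or> X = S - A \<or> X = A - S" for X
      proof (rule less.hyps[OF _ that(1)])
        \<comment> \<open>No member of \<open>\<L>\<close> crosses \<open>A\<close>, so
          \<open>X\<close> crosses only members that \<open>S\<close> crosses; \<open>A\<close>
          itself drops out, and the count strictly decreases.\<close>
        have "{B \<in> \<L>. intersecting X B} \<subseteq> {B \<in> \<L>. intersecting S B}"
          using uncrossing_intersecting[OF A(2) _ X] L(2) A(1) unfolding laminar_def by blast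
        moreover have "A \<notin> {B \<in> \<L>. intersecting X B}"
          using uncrossing_not_intersecting[OF X] by blast
        ultimately have "{B \<in> \<L>. intersecting X B} \<subset> {B \<in> \<L>. intersecting S B}"
          using A by blast
        then show "card {B \<in> \<L>. intersecting X B} < card {B \<in> \<L>. intersecting S B}"
          using finL by (intro psubset_card_mono) auto
      qed
      obtain X Y where "f X \<in> span (f ` \<L>)" "f Y \<in> span (f ` \<L>)" and eq: "f S + f A = f X + f Y"
        using uncross[OF less.prems _ A(2)] A(1) L(1) IH by blast
      moreover have "f A \<in> span (f ` \<L>)" using A(1) by (simp add: span_base)
      moreover have "f S = f X + f Y - f A" using eq by (simp add: algebra_simps)
      ultimately show ?thesis by (simp add: span_add span_diff)
    qed
  qed
  then show ?thesis using that L by blast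
qed

section \<open>Cuts and their submodularity\<close>

lemma mem_edge_cut_pair:
  assumes "u \<noteq> v"
  shows "{u, v} \<in> edge_cut E S \<longleftrightarrow> {u, v} \<in> E \<and> (u \<in> S) \<noteq> (v \<in> S)"
  using assms by (cases "u \<in> S"; cases "v \<in> S") (auto simp: edge_cut_def)

lemma simple_graph_edgeE:
  assumes "simple_graph V E" "e \<in> E"
  obtains u v where "e = {u, v}" "u \<noteq> v" "u \<in> V" "v \<in> V"
proof -
  have "e \<subseteq> V" "card e = 2" using assms by (auto simp: simple_graph_def)
  then show ?thesis using that by (auto simp: card_2_iff)
qed

lemma edge_cut_complement:
  assumes "simple_graph V E"
  shows "edge_cut E (V - S) = edge_cut E S"
proof -
  have "e \<in> edge_cut E (V - S) \<longleftrightarrow> e \<in> edge_cut E S" if e: "e \<in> E" for e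
  proof -
    obtain u v where "e = {u, v}" "u \<noteq> v" "u \<in> V" "v \<in> V"
      by (rule simple_graph_edgeE[OF assms e])
    then show ?thesis by (auto simp: mem_edge_cut_pair)
  qed
  then show ?thesis by (auto simp: edge_cut_def)
qed

text \<open>The two sides differ only on edges joining \<open>A - B\<close> to \<open>B - A\<close>,
  which count twice on the right and not at all on the left. The componentwise form of submodularity
  is what later yields an equation between vectors and not only between weights.\<close>

lemma incidence_edge_cut_Int_Un_le:
  assumes "simple_graph V E" "e \<in> E"
  shows "incidence (edge_cut E (A \<inter> B)) $ e + incidence (edge_cut E (A \<union> B)) $ e
    \<le> incidence (edge_cut E A) $ e + incidence (edge_cut E B) $ e"
  by (rule simple_graph_edgeE[OF assms]) (auto simp: incidence_def mem_edge_cut_pair)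

text \<open>This is the posimodular counterpart: here only edges joining \<open>A \<inter> B\<close>
  to nodes outside \<open>A \<union> B\<close> are lost.\<close>

lemma incidence_edge_cut_Diff_le:
  assumes "simple_graph V E" "e \<in> E"
  shows "incidence (edge_cut E (A - B)) $ e + incidence (edge_cut E (B - A)) $ e
    \<le> incidence (edge_cut E A) $ e + incidence (edge_cut E B) $ e"
  by (rule simple_graph_edgeE[OF assms]) (auto simp: incidence_def mem_edge_cut_pair)

section \<open>Edge vectors, positive weights and uncrossing of roots\<close>

lemma incidence_in_edge_space: "F \<subseteq> E \<Longrightarrow> incidence F \<in> edge_space E"
  by (auto simp: incidence_def edge_space_def)

lemma subspace_edge_space: "subspace (edge_space E)"
  by (auto simp: subspace_def edge_space_def)

lemma inner_edge_space:
  assumes "c \<in> edge_space E"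
  shows "c \<bullet> x = (\<Sum>e\<in>E. c $ e * x $ e)"
  using assms unfolding inner_vec_def
  by (auto intro!: sum.mono_neutral_cong_right simp: edge_space_def)

lemma weight_eq_inner:
  assumes "c \<in> edge_space E" "F \<subseteq> E"
  shows "weight c F = c \<bullet> incidence F"
  using assms(2)
  by (auto simp: inner_edge_space[OF assms(1)] weight_def incidence_def intro!: sum.mono_neutral_cong_left)

lemma steiner_cuts_subset: "F \<in> steiner_cuts V E T \<Longrightarrow> F \<subseteq> E"
  by (auto simp: steiner_cuts_def edge_cut_def)

lemma min_cut_weight_le: "F \<in> steiner_cuts V E T \<Longrightarrow> min_cut_weight V E T c \<le> weight c F"
  unfolding min_cut_weight_def by (intro Min_le) auto

text \<open>All terms \<open>c $ e * (y $ e - x $ e)\<close> are nonnegative while their sum is at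
  most 0, so each vanishes, and \<open>c $ e > 0\<close> can be cancelled.\<close>

lemma edge_space_eq_if_le_inner_ge:
  assumes "c \<in> edge_space E" "\<forall>e\<in>E. c $ e > 0"
    and "x \<in> edge_space E" "y \<in> edge_space E" "\<And>e. e \<in> E \<Longrightarrow> x $ e \<le> y $ e"
    and "c \<bullet> y \<le> c \<bullet> x"
  shows "x = y"
proof -
  have "(\<Sum>e\<in>E. c $ e * (y $ e - x $ e)) \<le> 0"
    using assms(6) by (simp add: inner_edge_space[OF assms(1)] right_diff_distrib sum_subtractf)
  moreover have nonneg: "\<forall>e\<in>E. c $ e * (y $ e - x $ e) \<ge> 0"
    using assms(2,5) by (simp add: less_imp_le)
  ultimately have "(\<Sum>e\<in>E. c $ e * (y $ e - x $ e)) = 0" by (meson antisym sum_nonneg)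
  then have "\<forall>e\<in>E. c $ e * (y $ e - x $ e) = 0"
    using nonneg by (subst (asm) sum_nonneg_eq_0_iff) auto
  then have "\<forall>e\<in>E. x $ e = y $ e" using assms(2) by fastforce
  then have "x $ e = y $ e" for e using assms(3,4) by (cases "e \<in> E") (auto simp: edge_space_def)
  then show ?thesis by (simp add: vec_eq_iff)
qed

text \<open>By minimality \<open>C\<close> and \<open>D\<close> together weigh at least as much as
  the roots \<open>A\<close> and \<open>B\<close>. With the edgewise inequality and positive weights
  this forces equality on every edge; the two weights, each at least the minimum, then sum to twice
  the minimum.\<close>

lemma roots_uncross:
  assumes c: "c \<in> edge_space E" "\<forall>e\<in>E. c $ e > 0"
    and A: "A \<in> roots V E T c" and B: "B \<in> roots V E T c"
    and C: "C \<in> steiner_cuts V E T" and D: "D \<in> steiner_cuts V E T"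
    and le: "\<And>e. e \<in> E \<Longrightarrow> incidence C $ e + incidence D $ e \<le> incidence A $ e + incidence B $ e"
  shows "C \<in> roots V E T c \<and> D \<in> roots V E T c \<and>
    incidence A + incidence B = incidence C + incidence D"
proof -
  let ?m = "min_cut_weight V E T c"
  have AB: "A \<in> steiner_cuts V E T" "B \<in> steiner_cuts V E T" "weight c A = ?m" "weight c B = ?m"
    using A B by (auto simp: roots_def)
  note sub = AB(1,2) C D
  have W: "weight c F = c \<bullet> incidence F" if "F \<in> steiner_cuts V E T" for F
    using weight_eq_inner[OF c(1) steiner_cuts_subset[OF that]] .
  have I: "incidence F \<in> edge_space E" if "F \<in> steiner_cuts V E T" for F
    using incidence_in_edge_space[OF steiner_cuts_subset[OF that]] .
  have ge: "?m \<le> weight c C" "?m \<le> weight c D" using C D by (auto intro: min_cut_weight_le)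
  have eq: "incidence C + incidence D = incidence A + incidence B"
  proof (rule edge_space_eq_if_le_inner_ge[OF c])
    show "c \<bullet> (incidence A + incidence B) \<le> c \<bullet> (incidence C + incidence D)"
      using ge AB(3,4) W sub by (simp add: inner_add_right)
  qed (use I sub le in \<open>auto intro: subspace_add[OF subspace_edge_space]\<close>)
  then have "c \<bullet> incidence C + c \<bullet> incidence D = c \<bullet> incidence A + c \<bullet> incidence B"
    by (metis inner_add_right)
  then have "weight c C + weight c D = ?m + ?m" using W sub AB(3,4) by simp
  then show ?thesis using ge C D eq by (auto simp: roots_def)
qed

section \<open>The facet and the span of the roots\<close>

lemma facet_in_span_roots:
  assumes c: "c \<in> edge_space E" "\<forall>e\<in>E. c $ e > 0"
    and x: "x \<in> cut_dominant V E T" "c \<bullet> x = min_cut_weight V E T c"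
  shows "x \<in> span (incidence ` roots V E T c)"
proof -
  let ?m = "min_cut_weight V E T c" and ?S = "steiner_cuts V E T"
  obtain p y where xy: "x = p + y" "p \<in> convex hull (incidence ` ?S)"
    "y \<in> edge_space E" "\<forall>e\<in>E. y $ e \<ge> 0"
    using x(1) unfolding cut_dominant_def by auto
  have W: "weight c F = c \<bullet> incidence F" if "F \<in> ?S" for F
    using weight_eq_inner[OF c(1) steiner_cuts_subset[OF that]] .
  obtain u where u: "\<forall>v\<in>incidence ` ?S. 0 \<le> u v" "sum u (incidence ` ?S) = 1"
    "(\<Sum>v\<in>incidence ` ?S. u v *\<^sub>R v) = p"
    using xy(2) by (subst (asm) convex_hull_finite) auto
  have ge: "c \<bullet> v \<ge> ?m" if "v \<in> incidence ` ?S" for v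
    using that W min_cut_weight_le[of _ V E T c] by fastforce
  have "c \<bullet> p = (\<Sum>v\<in>incidence ` ?S. u v * (c \<bullet> v))"
    by (simp flip: u(3) add: inner_sum_right)
  then have cp: "c \<bullet> p - ?m = (\<Sum>v\<in>incidence ` ?S. u v * (c \<bullet> v - ?m))"
    using u(2) by (simp add: right_diff_distrib sum_subtractf flip: sum_distrib_right)
  have nonneg: "\<And>v. v \<in> incidence ` ?S \<Longrightarrow> 0 \<le> u v * (c \<bullet> v - ?m)"
    using u(1) ge by (metis diff_ge_0_iff_ge mult_nonneg_nonneg)
  \<comment> \<open>The hull part alone already reaches the minimum, so \<open>c \<bullet> y\<close>
    cannot be positive, and the nonnegative part \<open>y\<close> vanishes.\<close>
  have "0 \<le> c \<bullet> p - ?m" unfolding cp by (rule sum_nonneg) (rule nonneg)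
  then have "c \<bullet> y \<le> c \<bullet> 0" using x(2) xy(1) by (simp add: inner_add_right)
  then have y0: "0 = y"
    by (intro edge_space_eq_if_le_inner_ge[OF c])
      (use xy subspace_0[OF subspace_edge_space] in auto)
  then have "(\<Sum>v\<in>incidence ` ?S. u v * (c \<bullet> v - ?m)) = 0" using cp x(2) xy(1) by simp
  \<comment> \<open>Complementary slackness: a Steiner cut with nonzero coefficient in
    \<open>p\<close> must be a root.\<close>
  then have tight: "\<forall>v\<in>incidence ` ?S. u v * (c \<bullet> v - ?m) = 0"
    using nonneg by (subst (asm) sum_nonneg_eq_0_iff) auto
  have "u v *\<^sub>R v \<in> span (incidence ` roots V E T c)" if v: "v \<in> incidence ` ?S" for v
  proof (cases "u v = 0")
    case False
    then have "c \<bullet> v = ?m" using tight v by auto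
    then have "v \<in> incidence ` roots V E T c" using v W unfolding roots_def by auto
    then show ?thesis by (simp add: span_base span_scale)
  qed (simp add: span_zero)
  then have "p \<in> span (incidence ` roots V E T c)" unfolding u(3)[symmetric] by (intro span_sum)
  then show ?thesis using xy(1) y0 by simp
qed

text \<open>The dominant contains a translate of the nonnegative orthant of the edge space, and this
  orthant contains all unit vectors of edges.\<close>

lemma aff_dim_cut_dominant_ge:
  assumes "cut_dominant V E T \<noteq> {}"
  shows "int (dim (edge_space E)) \<le> aff_dim (cut_dominant V E T)"
proof -
  obtain p where p: "p \<in> convex hull (incidence ` steiner_cuts V E T)"
    using assms unfolding cut_dominant_def by auto
  have sub: "(\<lambda>y. p + y) ` {y \<in> edge_space E. \<forall>e\<in>E. y $ e \<ge> 0} \<subseteq> cut_dominant V E T"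
    using p unfolding cut_dominant_def by blast
  let ?N = "{y \<in> edge_space E. \<forall>e\<in>E. y $ e \<ge> 0}"
  have "edge_space E \<subseteq> span ?N"
  proof
    fix x assume x: "x \<in> edge_space E"
    have "x = (\<Sum>e\<in>UNIV. x $ e *\<^sub>R axis e 1)"
      by (simp add: basis_expansion scalar_mult_eq_scaleR[symmetric])
    moreover have "x $ e *\<^sub>R axis e 1 \<in> span ?N" for e
    proof (cases "e \<in> E")
      case True
      then have "axis e 1 \<in> ?N" by (auto simp: edge_space_def axis_def)
      then show ?thesis by (simp add: span_base span_scale)
    next
      case False
      then have "x $ e = 0" using x by (simp add: edge_space_def)
      then show ?thesis by (simp add: span_zero)
    qed
    ultimately show "x \<in> span ?N" by (metis (no_types, lifting) span_sum)
  qed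
  then have "dim (edge_space E) \<le> dim (span ?N)" by (rule dim_subset)
  then have "dim (edge_space E) \<le> dim ?N" by (simp only: dim_span)
  then have "int (dim (edge_space E)) \<le> int (dim ?N)" by simp
  \<comment> \<open>The orthant contains the origin, so its linear and affine dimensions
    agree.\<close>
  also have "int (dim ?N) = aff_dim ?N"
    by (intro aff_dim_zero[symmetric] hull_inc) (simp add: edge_space_def)
  also have "\<dots> = aff_dim ((\<lambda>y. p + y) ` ?N)" by (simp add: aff_dim_translation_eq)
  also have "\<dots> \<le> aff_dim (cut_dominant V E T)" using sub by (rule aff_dim_subset)
  finally show ?thesis by simp
qed

lemma span_roots:
  assumes "facet_weights V E T c"
  shows "span (incidence ` roots V E T c) = edge_space E"
proof -
  let ?m = "min_cut_weight V E T c" and ?P = "cut_dominant V E T"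
  let ?R = "incidence ` roots V E T c"
  define F where "F = {x \<in> ?P. c \<bullet> x = ?m}"
  have c: "c \<in> edge_space E" "\<forall>e\<in>E. c $ e > 0" and pos: "?m > 0" and facet: "F facet_of ?P"
    using assms by (auto simp: facet_weights_def defines_facet_def F_def)
  have F: "F \<noteq> {}" "aff_dim F = aff_dim ?P - 1" using facet by (auto simp: facet_of_def)
  have "F \<subseteq> {x. c \<bullet> x = ?m}" by (auto simp: F_def)
  then have "affine hull F \<subseteq> {x. c \<bullet> x = ?m}" by (rule hull_minimal) (rule affine_hyperplane)
  \<comment> \<open>Positivity of the minimum keeps the origin off the hyperplane, so adjoining it
    to \<open>F\<close> regains the one dimension that a facet lacks.\<close>
  then have "0 \<notin> affine hull F" using pos by auto
  then have "aff_dim (insert 0 F) = aff_dim ?P" using F by (simp add: aff_dim_insert)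
  moreover have "?P \<noteq> {}" using F(1) by (auto simp: F_def)
  ultimately have "int (dim (edge_space E)) \<le> aff_dim (insert 0 F)"
    using aff_dim_cut_dominant_ge by metis
  also have "\<dots> \<le> aff_dim (span ?R)"
    using facet_in_span_roots[OF c] by (intro aff_dim_subset) (auto simp: F_def span_zero)
  also have "\<dots> = int (dim (span ?R))" by (intro aff_dim_subspace subspace_span)
  finally have dim: "dim (edge_space E) \<le> dim (span ?R)" by simp
  have "?R \<subseteq> edge_space E"
    by (auto simp: roots_def intro!: incidence_in_edge_space dest!: steiner_cuts_subset)
  then have "span ?R \<subseteq> edge_space E" using span_minimal subspace_edge_space by blast
  then show ?thesis
    using dim subspace_dim_equal[OF subspace_span subspace_edge_space] by blast
qed

section \<open>Shores of roots and the laminar basis\<close>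

lemma root_shores_uncross:
  assumes G: "simple_graph V E" and c: "c \<in> edge_space E" "\<forall>e\<in>E. c $ e > 0"
    and \<S>: "\<S> = {S. S \<subseteq> V - {r} \<and> T \<inter> S \<noteq> {} \<and> T - S \<noteq> {} \<and> edge_cut E S \<in> roots V E T c}"
    and A: "A \<in> \<S>" and B: "B \<in> \<S>"
  defines "f \<equiv> \<lambda>S. incidence (edge_cut E S)"
  shows "(A \<inter> B \<in> \<S> \<and> A \<union> B \<in> \<S> \<and> f A + f B = f (A \<inter> B) + f (A \<union> B)) \<or>
    (A - B \<in> \<S> \<and> B - A \<in> \<S> \<and> f A + f B = f (A - B) + f (B - A))"
proof -
  have AB: "edge_cut E A \<in> roots V E T c" "edge_cut E B \<in> roots V E T c" "A \<subseteq> V - {r}" "B \<subseteq> V - {r}"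
    using A B unfolding \<S> by auto
  \<comment> \<open>Common to both uncrossings: it remains to check that the new shores split
    \<open>T\<close> and that submodularity applies.\<close>
  have *: "C \<in> \<S> \<and> D \<in> \<S> \<and> f A + f B = f C + f D"
    if C: "C \<subseteq> V - {r}" "T \<inter> C \<noteq> {}" "T - C \<noteq> {}"
      and D: "D \<subseteq> V - {r}" "T \<inter> D \<noteq> {}" "T - D \<noteq> {}"
      and le: "\<And>e. e \<in> E \<Longrightarrow> incidence (edge_cut E C) $ e + incidence (edge_cut E D) $ e
        \<le> incidence (edge_cut E A) $ e + incidence (edge_cut E B) $ e" for C D
  proof -
    have "edge_cut E C \<in> steiner_cuts V E T" "edge_cut E D \<in> steiner_cuts V E T"
      using C D unfolding steiner_cuts_def by blast+
    from roots_uncross[OF c AB(1,2) this le] show ?thesis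
      using C D unfolding \<S> f_def by blast
  qed
  show ?thesis
  proof (cases "T \<inter> (A \<inter> B) \<noteq> {} \<and> T - (A \<union> B) \<noteq> {}")
    case True
    have "A \<inter> B \<in> \<S> \<and> A \<union> B \<in> \<S> \<and> f A + f B = f (A \<inter> B) + f (A \<union> B)"
      by (rule *) (use True AB(3,4) incidence_edge_cut_Int_Un_le[OF G] in auto)
    then show ?thesis ..
  next
    case False
    have ne: "T \<inter> A \<noteq> {}" "T - A \<noteq> {}" "T \<inter> B \<noteq> {}" "T - B \<noteq> {}"
      using A B unfolding \<S> by auto
    \<comment> \<open>If no terminal lies in \<open>A \<inter> B\<close>, the terminals of
      \<open>A\<close> lie in \<open>A - B\<close>; if every terminal lies in
      \<open>A \<union> B\<close>, those outside \<open>B\<close> do. The same holds with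
      \<open>A\<close> and \<open>B\<close> exchanged.\<close>
    have d: "T \<inter> (A - B) \<noteq> {}" "T \<inter> (B - A) \<noteq> {}" using False ne by blast+
    have "A - B \<in> \<S> \<and> B - A \<in> \<S> \<and> f A + f B = f (A - B) + f (B - A)"
      by (rule *) (use d AB(3,4) incidence_edge_cut_Diff_le[OF G] in auto)
    then show ?thesis ..
  qed
qed

theorem theorem1:
  fixes V :: "'v::finite set" and E :: "'v set set" and T :: "'v set"
    and c :: "real ^ ('v set)"
  assumes "steiner_graph V E T"
    and "facet_inducing V E T"
    and "facet_weights V E T c"
  shows "\<exists>\<L>. \<L> \<subseteq> Pow V \<and> laminar \<L> \<and> inj_on (edge_cut E) \<L> \<and> root_basis V E T c (edge_cut E ` \<L>)"
proof -
  have G: "simple_graph V E" and "T \<subseteq> V" "V \<noteq> {}"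
    using assms(1) by (auto simp: steiner_graph_def connected_graph_def)
  have c: "c \<in> edge_space E" "\<forall>e\<in>E. c $ e > 0" using assms(3) by (auto simp: facet_weights_def)
  let ?f = "\<lambda>S. incidence (edge_cut E S)"
  obtain r where "r \<in> V" using \<open>V \<noteq> {}\<close> by blast
  define \<S> where "\<S> = {S. S \<subseteq> V - {r} \<and> T \<inter> S \<noteq> {} \<and> T - S \<noteq> {} \<and> edge_cut E S \<in> roots V E T c}"
  have "incidence ` roots V E T c \<subseteq> ?f ` \<S>"
  proof
    fix x assume "x \<in> incidence ` roots V E T c"
    then obtain S where S: "x = ?f S" "edge_cut E S \<in> roots V E T c" "S \<subseteq> V" "T \<inter> S \<noteq> {}" "T - S \<noteq> {}"
      by (auto simp: roots_def steiner_cuts_def)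
    show "x \<in> ?f ` \<S>"
    proof (cases "r \<in> S")
      case True
      \<comment> \<open>The complementary shore avoids \<open>r\<close>, has the same cut, and still
        splits the terminals as \<open>T \<subseteq> V\<close>.\<close>
      then have "V - S \<in> \<S>"
        using S \<open>T \<subseteq> V\<close> edge_cut_complement[OF G, of S] by (auto simp: \<S>_def)
      then show ?thesis using S(1) edge_cut_complement[OF G, of S] by (metis imageI)
    qed (use S in \<open>auto simp: \<S>_def\<close>)
  qed
  moreover obtain \<K> where K: "\<K> \<subseteq> \<S>" "laminar \<K>" "?f ` \<S> \<subseteq> span (?f ` \<K>)"
    by (rule laminar_spanning_subfamily[of \<S> ?f, OF finite root_shores_uncross[OF G c \<S>_def]])
  ultimately have "incidence ` roots V E T c \<subseteq> span (?f ` \<K>)" by (meson subset_trans)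
  then have "edge_space E \<subseteq> span (?f ` \<K>)"
    unfolding span_roots[OF assms(3), symmetric] by (rule span_minimal) (rule subspace_span)
  moreover have "?f ` \<K> \<subseteq> edge_space E"
    by (auto intro!: incidence_in_edge_space simp: edge_cut_def)
  ultimately have span: "span (?f ` \<K>) = edge_space E"
    using span_minimal[OF _ subspace_edge_space] by blast
  \<comment> \<open>The spanning vectors of \<open>\<K>\<close> may be dependent, so a basis is
    extracted. Choosing one shore for each basis vector gives a subfamily \<open>\<L>\<close>, still
    laminar, on which distinct shores have distinct cuts.\<close>
  obtain \<B> where B: "\<B> \<subseteq> ?f ` \<K>" "independent \<B>" "?f ` \<K> \<subseteq> span \<B>"
    by (rule basis_exists) blast
  then obtain \<L> where L: "\<L> \<subseteq> \<K>" "inj_on ?f \<L>" "\<B> = ?f ` \<L>"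
    by (auto simp: subset_image_inj)
  have "span \<B> = edge_space E"
    using B span by (metis antisym span_minimal span_mono subspace_span)
  then have "root_basis V E T c (edge_cut E ` \<L>)"
    using L B(2) K(1) unfolding root_basis_def \<S>_def by (auto simp: image_image)
  moreover have "inj_on (edge_cut E) \<L>" using L(2) by (auto simp: inj_on_def)
  moreover have "laminar \<L>" using K(2) L(1) by (rule laminar_subset)
  moreover have "\<L> \<subseteq> Pow V" using L(1) K(1) by (auto simp: \<S>_def)
  ultimately show ?thesis by blast
qed

end
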